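(* In LP$^{\mathrm{MLN}}$ (i.e. with respect to semi-strong equivalence $\equiv_{s,s}$): the S-RD-1 transformation is neither SE-preserving nor NSE-preserving; and the S-RD-2 transformation is SE-preserving but not NSE-preserving.
   Context: Atoms are propositional. A rule $r$ is an expression $h_1\vee\cdots\vee h_k\leftarrow b_1,\dots,b_m,\mathit{not}\,c_1,\dots,\mathit{not}\,c_n$; write $H(r)$, $B^+(r)$, $B^-(r)$ for the sets of head, positive body and negative body atoms. A program is a finite set of rules. An interpretation $X$ satisfies $r$ iff $X\cap H(r)\neq\emptyset$ or $B^+(r)\not\subseteq X$ or $B^-(r)\cap X\neq\emptyset$. GL-reduct $P^X=\{H(r)\leftarrow B^+(r) : r\in P,\ B^-(r)\cap X=\emptyset\}$; $X$ is an ASP stable model of $P$ iff $X\models P^X$ and no proper subset of $X$ satisfies $P^X$. Weights of LP$^{\mathrm{MLN}}$ rules are omitted; $X$ is an LP$^{\mathrm{MLN}}$ stable model of $P$ iff $X$ is an ASP stable model of $\{r\in P: X\models r\}$. $P\equiv_{s,s}Q$ iff for every program $R$, $P\cup R$ and $Q\cup R$ have the same LP$^{\mathrm{MLN}}$ stable models. Programs are regarded as tuples of rules; $\langle P,Q\rangle$ is the concatenation. For a tuple $T=\langle r_1,\dots,r_n\rangle$ let $\langle S_1,\dots,S_{3n}\rangle=\langle H(r_1),B^+(r_1),B^-(r_1),\dots,H(r_n),B^+(r_n),B^-(r_n)\rangle$; for nonempty $N'\subseteq\{1,\dots,3n\}$ the independent set is $I_{N'}=\bigcap_{i\in N'}S_i\setminus\bigcup_{j\notin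 N'}S_j$. For $i\in\{1,2\}$, the S-RD-$i$ transformation deletes some atom $a\in I$ from an independent set $I$ with $|I|=i$, i.e. removes $a$ from every rule of $T$. For a pair $T=\langle P,Q\rangle$ the result is $\langle P^\circ,Q^\circ\rangle$ with $P^\circ$ the first $|P|$ rules. A transformation type is SE-preserving if for every pair $\langle P,Q\rangle$ and every admissible application $P\equiv_{s,s}Q$ implies $P^\circ\equiv_{s,s}Q^\circ$, and NSE-preserving if $P\not\equiv_{s,s}Q$ implies $P^\circ\not\equiv_{s,s}Q^\circ$. *)

theory Defs
  imports Main "HOL-Library.FSet"
begin

datatype 'a lprule = LPRule (H: "'a fset") (Bpos: "'a fset") (Bneg: "'a fset")

text \<open>
  Programs are tuples of rules, rendered as lists; the semantics only looks at the underlying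
  finite set of rules.
\<close>

type_synonym 'a program = "'a lprule list"

definition sat_rule :: "'a set \<Rightarrow> 'a lprule \<Rightarrow> bool" where
  "sat_rule X r \<longleftrightarrow>
     X \<inter> fset (H r) \<noteq> {} \<or> \<not> fset (Bpos r) \<subseteq> X \<or> fset (Bneg r) \<inter> X \<noteq> {}"

definition sat :: "'a set \<Rightarrow> 'a lprule set \<Rightarrow> bool" where
  "sat X P \<longleftrightarrow> (\<forall>r\<in>P. sat_rule X r)"

definition GL_reduct :: "'a lprule set \<Rightarrow> 'a set \<Rightarrow> 'a lprule set" where
  "GL_reduct P X = {LPRule (H r) (Bpos r) {||} | r. r \<in> P \<and> fset (Bneg r) \<inter> X = {}}"

definition ASP_stable :: "'a set \<Rightarrow> 'a lprule set \<Rightarrow> bool" where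
  "ASP_stable X P \<longleftrightarrow> sat X (GL_reduct P X) \<and> (\<forall>Y. Y \<subset> X \<longrightarrow> \<not> sat Y (GL_reduct P X))"

definition LPMLN_stable :: "'a set \<Rightarrow> 'a lprule set \<Rightarrow> bool" where
  "LPMLN_stable X P \<longleftrightarrow> ASP_stable X {r \<in> P. sat_rule X r}"

definition semi_strong_equiv :: "'a program \<Rightarrow> 'a program \<Rightarrow> bool" (infix "\<equiv>\<^sub>s\<^sub>s" 50) where
  "P \<equiv>\<^sub>s\<^sub>s Q \<longleftrightarrow>
     (\<forall>R :: 'a program. \<forall>X. LPMLN_stable X (set P \<union> set R) \<longleftrightarrow> LPMLN_stable X (set Q \<union> set R))"

definition comp_sets :: "'a lprule list \<Rightarrow> 'a set list" where
  "comp_sets T = concat (map (\<lambda>r. [fset (H r), fset (Bpos r), fset (Bneg r)]) T)"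

text \<open>The positions \<open>1, \<dots>, 3n\<close> are shifted to \<open>0, \<dots>, 3n - 1\<close>.\<close>

definition indep_set :: "'a lprule list \<Rightarrow> nat set \<Rightarrow> 'a set" where
  "indep_set T N' =
     (\<Inter>i\<in>N'. comp_sets T ! i) - (\<Union>j\<in>{..<3 * length T} - N'. comp_sets T ! j)"

definition is_indep_set :: "'a lprule list \<Rightarrow> 'a set \<Rightarrow> bool" where
  "is_indep_set T I \<longleftrightarrow> (\<exists>N'. N' \<noteq> {} \<and> N' \<subseteq> {..<3 * length T} \<and> I = indep_set T N')"

definition del_atom :: "'a \<Rightarrow> 'a lprule \<Rightarrow> 'a lprule" where
  "del_atom a r = LPRule (H r |-| {|a|}) (Bpos r |-| {|a|}) (Bneg r |-| {|a|})"

text \<open>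
  A transformation type is the relation between a pair of programs and the possible results of an
  admissible application.
\<close>

type_synonym 'a transformation = "'a program \<times> 'a program \<Rightarrow> 'a program \<times> 'a program \<Rightarrow> bool"

definition S_RD :: "nat \<Rightarrow> 'a transformation" where
  "S_RD i = (\<lambda>(P, Q) (P', Q').
     \<exists>I a. is_indep_set (P @ Q) I \<and> card I = i \<and> a \<in> I \<and>
       P' = take (length P) (map (del_atom a) (P @ Q)) \<and>
       Q' = drop (length P) (map (del_atom a) (P @ Q)))"

definition SE_preserving :: "'a transformation \<Rightarrow> bool" where
  "SE_preserving \<tau> \<longleftrightarrow>
     (\<forall>P Q P' Q'. \<tau> (P, Q) (P', Q') \<longrightarrow> P \<equiv>\<^sub>s\<^sub>s Q \<longrightarrow> P' \<equiv>\<^sub>s\<^sub>s Q')"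

definition NSE_preserving :: "'a transformation \<Rightarrow> bool" where
  "NSE_preserving \<tau> \<longleftrightarrow>
     (\<forall>P Q P' Q'. \<tau> (P, Q) (P', Q') \<longrightarrow> \<not> P \<equiv>\<^sub>s\<^sub>s Q \<longrightarrow> \<not> P' \<equiv>\<^sub>s\<^sub>s Q')"

end

theory Submission imports Defs begin

text \<open>
  Two programs are semi-strongly equivalent iff they have the same SE-models: a given pair
  \<open>(Y, X)\<close> is tested by adding a program whose only SE-models with second component \<open>X\<close> are \<open>(Y, X)\<close>
  and \<open>(X, X)\<close>. The independent set containing \<open>a\<close> consists of the atoms that occur at the same
  positions as \<open>a\<close>. If \<open>c \<noteq> a\<close> is such an atom, then \<open>(Y, X)\<close> is an SE-model after the deletion of
  \<open>a\<close> iff it was one before, once \<open>a\<close> has been given the status of \<open>c\<close> in \<open>Y\<close> and \<open>X\<close>. Hence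
  S-RD-2 preserves equivalence. The converse fails because pairs in which \<open>a\<close> and \<open>c\<close> differ in
  status are ignored after the deletion.
\<close>

subsection \<open>SE-models\<close>

definition SE_models :: "'a lprule set \<Rightarrow> ('a set \<times> 'a set) set" where
  "SE_models P = {(Y, X). Y \<subseteq> X \<and> sat Y (GL_reduct {r \<in> P. sat_rule X r} X)}"

definition refutes :: "'a set \<Rightarrow> 'a set \<Rightarrow> 'a lprule \<Rightarrow> bool" where
  "refutes Y X r \<longleftrightarrow> fset (Bneg r) \<inter> X = {} \<and> fset (Bpos r) \<subseteq> Y \<and> fset (H r) \<inter> Y = {}
     \<and> fset (H r) \<inter> X \<noteq> {}"

lemma SE_models_iff_refutes: "(Y, X) \<in> SE_models P \<longleftrightarrow> Y \<subseteq> X \<and> (\<forall>r\<in>P. \<not> refutes Y X r)"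
proof -
  have "refutes Y X r \<longleftrightarrow>
      sat_rule X r \<and> fset (Bneg r) \<inter> X = {} \<and> \<not> sat_rule Y (LPRule (H r) (Bpos r) {||})"
    if "Y \<subseteq> X" for r
    using that unfolding sat_rule_def refutes_def by auto
  then show ?thesis
    unfolding SE_models_def sat_def GL_reduct_def by blast
qed

lemma SE_models_Un: "SE_models (P \<union> Q) = SE_models P \<inter> SE_models Q"
  by (auto simp: SE_models_iff_refutes)

lemma SE_models_subset: "(Y, X) \<in> SE_models P \<Longrightarrow> Y \<subseteq> X"
  by (simp add: SE_models_def)

lemma SE_models_refl: "(X, X) \<in> SE_models P"
  by (auto simp: SE_models_iff_refutes refutes_def)

lemma LPMLN_stable_iff_SE_models: "LPMLN_stable X P \<longleftrightarrow> (\<forall>Y. (Y, X) \<in> SE_models P \<longrightarrow> Y = X)"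
  using SE_models_refl[of X P]
  unfolding LPMLN_stable_def ASP_stable_def SE_models_def by auto

definition atoms :: "'a lprule set \<Rightarrow> 'a set" where
  "atoms P = (\<Union>r\<in>P. fset (H r) \<union> fset (Bpos r) \<union> fset (Bneg r))"

lemma finite_atoms: "finite P \<Longrightarrow> finite (atoms P)"
  by (simp add: atoms_def)

lemma SE_models_Int_atoms:
  assumes "atoms P \<subseteq> A" "Y \<subseteq> X"
  shows "(Y \<inter> A, X \<inter> A) \<in> SE_models P \<longleftrightarrow> (Y, X) \<in> SE_models P"
proof -
  have "refutes (Y \<inter> A) (X \<inter> A) r \<longleftrightarrow> refutes Y X r" if "r \<in> P" for r
  proof -
    have "fset (H r) \<subseteq> A" "fset (Bpos r) \<subseteq> A" "fset (Bneg r) \<subseteq> A"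
      using assms(1) that by (auto simp: atoms_def)
    then show ?thesis unfolding refutes_def by blast
  qed
  then show ?thesis using assms(2) by (auto simp: SE_models_iff_refutes)
qed

subsection \<open>Semi-strong equivalence\<close>

definition separator :: "'a set \<Rightarrow> 'a set \<Rightarrow> 'a lprule set" where
  "separator Y X = (\<lambda>a. LPRule {|a|} {||} {||}) ` Y
     \<union> (\<lambda>(a, b). LPRule {|a|} {|b|} {||}) ` ((X - Y) \<times> (X - Y))"

lemma finite_separator: "finite X \<Longrightarrow> Y \<subseteq> X \<Longrightarrow> finite (separator Y X)"
  unfolding separator_def by (auto intro: finite_subset)

lemma SE_models_separator_iff:
  assumes "Y \<subseteq> X"
  shows "(Z, X) \<in> SE_models (separator Y X) \<longleftrightarrow> Z = Y \<or> Z = X"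
proof -
  have "(Z, X) \<in> SE_models (separator Y X) \<longleftrightarrow>
      Z \<subseteq> X \<and> Y \<subseteq> Z \<and> (\<forall>a\<in>X - Y. \<forall>b\<in>X - Y. b \<in> Z \<longrightarrow> a \<in> Z)"
    using assms unfolding SE_models_iff_refutes separator_def ball_Un
    by (auto simp: refutes_def)
  also have "\<dots> \<longleftrightarrow> Z = Y \<or> Z = X"
    using assms by blast
  finally show ?thesis .
qed

lemma LPMLN_stable_Un_separator:
  assumes "Y \<subset> X"
  shows "LPMLN_stable X (P \<union> separator Y X) \<longleftrightarrow> (Y, X) \<notin> SE_models P"
  using assms by (auto simp: LPMLN_stable_iff_SE_models SE_models_Un SE_models_separator_iff)

lemma semi_strong_equiv_finite_SE_models:
  assumes "P \<equiv>\<^sub>s\<^sub>s Q" "finite X"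
  shows "(Y, X) \<in> SE_models (set P) \<longleftrightarrow> (Y, X) \<in> SE_models (set Q)"
proof -
  consider (proper) "Y \<subset> X" | (total) "Y = X" | (no_pair) "\<not> Y \<subseteq> X" by blast
  then show ?thesis
  proof cases
    case proper
    then obtain R where R: "set R = separator Y X"
      using finite_list[OF finite_separator[OF assms(2)]] by blast
    have "LPMLN_stable X (set P \<union> set R) \<longleftrightarrow> LPMLN_stable X (set Q \<union> set R)"
      using assms(1) unfolding semi_strong_equiv_def by blast
    with proper show ?thesis by (simp add: R LPMLN_stable_Un_separator)
  qed (simp_all add: SE_models_refl SE_models_iff_refutes)
qed

theorem semi_strong_equiv_iff_SE_models: "P \<equiv>\<^sub>s\<^sub>s Q \<longleftrightarrow> SE_models (set P) = SE_models (set Q)"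
proof
  assume equiv: "P \<equiv>\<^sub>s\<^sub>s Q"
  define A where "A = atoms (set P \<union> set Q)"
  have "finite A" unfolding A_def by (simp add: finite_atoms)
  have "atoms (set P) \<subseteq> A" "atoms (set Q) \<subseteq> A" by (auto simp: A_def atoms_def)
  then have "(Y, X) \<in> SE_models (set P) \<longleftrightarrow> (Y, X) \<in> SE_models (set Q)" if "Y \<subseteq> X" for Y X
    using semi_strong_equiv_finite_SE_models[OF equiv, of "X \<inter> A" "Y \<inter> A"] \<open>finite A\<close> that
    by (simp add: SE_models_Int_atoms)
  then show "SE_models (set P) = SE_models (set Q)"
    by (auto dest: SE_models_subset)
next
  assume "SE_models (set P) = SE_models (set Q)"
  then show "P \<equiv>\<^sub>s\<^sub>s Q"
    by (simp add: semi_strong_equiv_def LPMLN_stable_iff_SE_models SE_models_Un)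
qed

lemma semi_strong_equiv_iff_refutes:
  "P \<equiv>\<^sub>s\<^sub>s Q \<longleftrightarrow> (\<forall>Y X. Y \<subseteq> X \<longrightarrow> (\<exists>r\<in>set P. refutes Y X r) = (\<exists>r\<in>set Q. refutes Y X r))"
  unfolding semi_strong_equiv_iff_SE_models set_eq_iff split_paired_All SE_models_iff_refutes
  by (intro iff_allI) blast

subsection \<open>Independent sets\<close>

definition same_occurrences :: "'a lprule \<Rightarrow> 'a \<Rightarrow> 'a \<Rightarrow> bool" where
  "same_occurrences r a c \<longleftrightarrow>
     (a |\<in>| H r \<longleftrightarrow> c |\<in>| H r) \<and> (a |\<in>| Bpos r \<longleftrightarrow> c |\<in>| Bpos r) \<and> (a |\<in>| Bneg r \<longleftrightarrow> c |\<in>| Bneg r)"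

definition occurrence_class :: "'a lprule set \<Rightarrow> 'a \<Rightarrow> 'a set" where
  "occurrence_class P a = {c. \<forall>r\<in>P. same_occurrences r a c}"

lemma length_comp_sets: "length (comp_sets T) = 3 * length T"
  by (induction T) (simp_all add: comp_sets_def)

lemma set_comp_sets: "set (comp_sets T) = (\<Union>r\<in>set T. {fset (H r), fset (Bpos r), fset (Bneg r)})"
  by (simp add: comp_sets_def)

lemma mem_atoms_iff_nth_comp_sets:
  "a \<in> atoms (set T) \<longleftrightarrow> (\<exists>i<3 * length T. a \<in> comp_sets T ! i)"
proof -
  have "a \<in> atoms (set T) \<longleftrightarrow> (\<exists>S\<in>set (comp_sets T). a \<in> S)"
    by (auto simp: atoms_def set_comp_sets)
  then show ?thesis by (metis in_set_conv_nth length_comp_sets)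
qed

lemma mem_occurrence_class_iff_nth_comp_sets:
  "c \<in> occurrence_class (set T) a \<longleftrightarrow>
     (\<forall>i<3 * length T. a \<in> comp_sets T ! i \<longleftrightarrow> c \<in> comp_sets T ! i)"
proof -
  have "c \<in> occurrence_class (set T) a \<longleftrightarrow> (\<forall>S\<in>set (comp_sets T). a \<in> S \<longleftrightarrow> c \<in> S)"
    by (auto simp: occurrence_class_def same_occurrences_def set_comp_sets)
  then show ?thesis by (simp add: all_set_conv_all_nth length_comp_sets)
qed

lemma mem_indep_set_iff:
  assumes "N \<subseteq> {..<3 * length T}"
  shows "c \<in> indep_set T N \<longleftrightarrow> (\<forall>i<3 * length T. c \<in> comp_sets T ! i \<longleftrightarrow> i \<in> N)"
  using assms by (auto simp: indep_set_def)

lemma indep_set_eq_occurrence_class: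
  assumes "N \<subseteq> {..<3 * length T}" "a \<in> indep_set T N"
  shows "indep_set T N = occurrence_class (set T) a"
  using assms by (auto simp: mem_indep_set_iff mem_occurrence_class_iff_nth_comp_sets)

theorem is_indep_set_iff_occurrence_class:
  "is_indep_set T I \<and> a \<in> I \<longleftrightarrow> a \<in> atoms (set T) \<and> I = occurrence_class (set T) a"
proof
  assume "is_indep_set T I \<and> a \<in> I"
  then obtain N where N: "N \<noteq> {}" "N \<subseteq> {..<3 * length T}"
    and I: "I = indep_set T N" and a: "a \<in> indep_set T N"
    by (auto simp: is_indep_set_def)
  have "a \<in> atoms (set T)"
    using N a by (auto simp: mem_indep_set_iff mem_atoms_iff_nth_comp_sets)
  then show "a \<in> atoms (set T) \<and> I = occurrence_class (set T) a"
    using indep_set_eq_occurrence_class[OF N(2) a] by (simp add: I)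
next
  assume a: "a \<in> atoms (set T) \<and> I = occurrence_class (set T) a"
  define N where "N = {i. i < 3 * length T \<and> a \<in> comp_sets T ! i}"
  have N: "N \<noteq> {}" "N \<subseteq> {..<3 * length T}"
    using a by (auto simp: N_def mem_atoms_iff_nth_comp_sets)
  then have "a \<in> indep_set T N"
    by (simp add: mem_indep_set_iff) (simp add: N_def)
  then show "is_indep_set T I \<and> a \<in> I"
    using a N indep_set_eq_occurrence_class[of N T a] by (auto simp: is_indep_set_def)
qed

lemma S_RD_iff:
  "S_RD i (P, Q) (P', Q') \<longleftrightarrow>
     (\<exists>a\<in>atoms (set P \<union> set Q). card (occurrence_class (set P \<union> set Q) a) = i \<and>
        P' = map (del_atom a) P \<and> Q' = map (del_atom a) Q)"
proof -
  have "S_RD i (P, Q) (P', Q') \<longleftrightarrow>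
      (\<exists>I a. (is_indep_set (P @ Q) I \<and> a \<in> I) \<and> card I = i \<and>
         P' = map (del_atom a) P \<and> Q' = map (del_atom a) Q)"
    by (auto simp: S_RD_def)
  then show ?thesis
    by (auto simp: is_indep_set_iff_occurrence_class)
qed

subsection \<open>Deletion from independent sets with at least two atoms\<close>

definition copy_status :: "'a \<Rightarrow> 'a \<Rightarrow> 'a set \<Rightarrow> 'a set" where
  "copy_status c a X = (if c \<in> X then insert a X else X - {a})"

lemma copy_status_mono: "Y \<subseteq> X \<Longrightarrow> copy_status c a Y \<subseteq> copy_status c a X"
  by (auto simp: copy_status_def)

lemma refutes_del_atom_iff:
  assumes "a \<noteq> c" "same_occurrences r a c"
  shows "refutes Y X (del_atom a r) \<longleftrightarrow> refutes (copy_status c a Y) (copy_status c a X) r"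
proof -
  have "(S - {a}) \<inter> Z = {} \<longleftrightarrow> S \<inter> copy_status c a Z = {}"
    and "S - {a} \<subseteq> Z \<longleftrightarrow> S \<subseteq> copy_status c a Z" if "a \<in> S \<longleftrightarrow> c \<in> S" for S Z
    using that assms(1) by (auto simp: copy_status_def)
  then show ?thesis
    using assms(2) by (simp add: refutes_def del_atom_def same_occurrences_def)
qed

lemma semi_strong_equiv_map_del_atom:
  assumes "P \<equiv>\<^sub>s\<^sub>s Q" "a \<noteq> c" "c \<in> occurrence_class (set P \<union> set Q) a"
  shows "map (del_atom a) P \<equiv>\<^sub>s\<^sub>s map (del_atom a) Q"
proof -
  have "refutes Y X (del_atom a r) \<longleftrightarrow> refutes (copy_status c a Y) (copy_status c a X) r"
    if "r \<in> set P \<union> set Q" for r Y X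
    using assms(2,3) that by (intro refutes_del_atom_iff) (auto simp: occurrence_class_def)
  then show ?thesis
    using assms(1) copy_status_mono[of _ _ c a] by (simp add: semi_strong_equiv_iff_refutes)
qed

theorem SE_preserving_S_RD:
  assumes "2 \<le> i"
  shows "SE_preserving (S_RD i :: 'a transformation)"
  unfolding SE_preserving_def
proof (intro allI impI)
  fix P Q P' Q' :: "'a program"
  assume "S_RD i (P, Q) (P', Q')" and equiv: "P \<equiv>\<^sub>s\<^sub>s Q"
  then obtain a where card: "card (occurrence_class (set P \<union> set Q) a) = i"
    and P': "P' = map (del_atom a) P" and Q': "Q' = map (del_atom a) Q"
    by (auto simp: S_RD_iff)
  have "\<not> occurrence_class (set P \<union> set Q) a \<subseteq> {a}"
    using assms card card_mono[of "{a}" "occurrence_class (set P \<union> set Q) a"] by auto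
  then obtain c where "c \<in> occurrence_class (set P \<union> set Q) a" "a \<noteq> c" by blast
  with equiv show "P' \<equiv>\<^sub>s\<^sub>s Q'"
    unfolding P' Q' by (intro semi_strong_equiv_map_del_atom)
qed

subsection \<open>Counterexamples\<close>

lemma not_semi_strong_equiv_fact_Nil: "\<not> [LPRule {|a|} {||} {||}] \<equiv>\<^sub>s\<^sub>s []"
proof -
  have "refutes {} {a} (LPRule {|a|} {||} {||})" by (simp add: refutes_def)
  then show ?thesis by (auto simp: semi_strong_equiv_iff_refutes)
qed

lemma not_SE_preserving_S_RD_1:
  assumes "(a :: 'a) \<noteq> b"
  shows "\<not> SE_preserving (S_RD 1 :: 'a transformation)"
proof
  let ?P = "[LPRule {|a, b|} {|a|} {||}]"
  assume "SE_preserving (S_RD 1 :: 'a transformation)"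
  moreover have "occurrence_class (set ?P \<union> set []) a = {a}"
    by (auto simp: occurrence_class_def same_occurrences_def)
  then have "S_RD 1 (?P, []) (map (del_atom a) ?P, [])"
    by (auto simp: S_RD_iff atoms_def)
  moreover have "?P \<equiv>\<^sub>s\<^sub>s []"
    by (auto simp: semi_strong_equiv_iff_refutes refutes_def)
  ultimately have "map (del_atom a) ?P \<equiv>\<^sub>s\<^sub>s []"
    unfolding SE_preserving_def by blast
  moreover have "map (del_atom a) ?P = [LPRule {|b|} {||} {||}]"
    using assms by (auto simp: del_atom_def)
  ultimately show False
    by (simp add: not_semi_strong_equiv_fact_Nil)
qed

lemma not_NSE_preserving_S_RD_1: "\<not> NSE_preserving (S_RD 1 :: 'a transformation)"
proof
  fix a :: 'a
  let ?P = "[LPRule {|a|} {||} {||}]"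
  assume "NSE_preserving (S_RD 1 :: 'a transformation)"
  moreover have "occurrence_class (set ?P \<union> set []) a = {a}"
    by (auto simp: occurrence_class_def same_occurrences_def)
  then have "S_RD 1 (?P, []) (map (del_atom a) ?P, [])"
    by (auto simp: S_RD_iff atoms_def)
  moreover have "map (del_atom a) ?P \<equiv>\<^sub>s\<^sub>s []"
    by (simp add: semi_strong_equiv_iff_refutes refutes_def del_atom_def)
  ultimately have "?P \<equiv>\<^sub>s\<^sub>s []"
    unfolding NSE_preserving_def by blast
  then show False
    by (simp add: not_semi_strong_equiv_fact_Nil)
qed

text \<open>
  A pair \<open>(Y, X)\<close> refuting the fact \<open>d\<close> refutes \<open>d \<leftarrow> a, c\<close> if \<open>a, c \<in> Y\<close> and refutes \<open>a \<or> c \<or> d \<leftarrow>\<close> if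
  \<open>a, c \<notin> Y\<close>; only \<open>Y\<close> that separate \<open>a\<close> from \<open>c\<close> escape.
\<close>

lemma not_NSE_preserving_S_RD_2:
  assumes "distinct [a :: 'a, c, d]"
  shows "\<not> NSE_preserving (S_RD 2 :: 'a transformation)"
proof
  let ?P = "[LPRule {|d|} {||} {||}, LPRule {|a, c, d|} {||} {||}]"
  let ?Q = "[LPRule {|d|} {|a, c|} {||}, LPRule {|a, c, d|} {||} {||}]"
  assume "NSE_preserving (S_RD 2 :: 'a transformation)"
  moreover have "occurrence_class (set ?P \<union> set ?Q) a = {a, c}"
    using assms by (auto simp: occurrence_class_def same_occurrences_def)
  then have "S_RD 2 (?P, ?Q) (map (del_atom a) ?P, map (del_atom a) ?Q)"
    using assms unfolding S_RD_iff by (intro bexI[of _ a]) (auto simp: atoms_def)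
  moreover have "map (del_atom a) ?P \<equiv>\<^sub>s\<^sub>s map (del_atom a) ?Q"
  proof -
    have "map (del_atom a) ?P = [LPRule {|d|} {||} {||}, LPRule {|c, d|} {||} {||}]"
      and "map (del_atom a) ?Q = [LPRule {|d|} {|c|} {||}, LPRule {|c, d|} {||} {||}]"
      using assms by (auto simp: del_atom_def)
    then show ?thesis
      by (auto simp: semi_strong_equiv_iff_refutes refutes_def)
  qed
  ultimately have "?P \<equiv>\<^sub>s\<^sub>s ?Q"
    unfolding NSE_preserving_def by blast
  then have "(\<exists>r\<in>set ?P. refutes {a} {a, d} r) \<longleftrightarrow> (\<exists>r\<in>set ?Q. refutes {a} {a, d} r)"
    unfolding semi_strong_equiv_iff_refutes by (elim allE impE) auto
  then show False
    using assms by (simp add: refutes_def)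
qed

theorem theorem4:
  assumes "infinite (UNIV :: 'a set)"
  shows "\<not> SE_preserving (S_RD 1 :: 'a transformation)
       \<and> \<not> NSE_preserving (S_RD 1 :: 'a transformation)
       \<and> SE_preserving (S_RD 2 :: 'a transformation)
       \<and> \<not> NSE_preserving (S_RD 2 :: 'a transformation)"
proof -
  obtain A :: "'a set" where "card A = 3"
    using infinite_arbitrarily_large[OF assms] by blast
  then obtain a c d :: 'a where "distinct [a, c, d]"
    by (auto simp: card_3_iff)
  then show ?thesis
    using not_SE_preserving_S_RD_1[of a c] not_NSE_preserving_S_RD_1 SE_preserving_S_RD[of 2]
      not_NSE_preserving_S_RD_2[of a c d] by simp
qed

end
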